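(* Let $\lambda>0$, $\sigma>0$, $t\ge 1$, let $y_i=x_i+\epsilon_i$ ($1\le i\le n$) with $\epsilon_1,\dots,\epsilon_n$ i.i.d. $N(0,\sigma^2)$, where $(x_i)_{i=1}^n$ is constant on each of the $K$ intervals $\{n_k,\dots,n_{k+1}-1\}$, $1\le k\le K$, and let $(\hat x_i)_{i=1}^n$ be the minimizer of $$\sum_{i=1}^n(x_i-y_i)^2+\lambda\sum_{i=1}^{n-1}|x_i-x_{i+1}|$$ over $\mathbb{R}^n$. Let $m_k=n_{k+1}-n_k$; for $1\le i\le n$ let $k(i)$ be the index with $n_{k(i)}\le i\le n_{k(i)+1}-1$, and let $d_i=\min(i+1-n_{k(i)},\,n_{k(i)+1}-i)$. Let $M_y=2\sigma\sqrt{\log n+\log t}$. Then with probability at least $1-1/t^2$, for all $1\le i\le n$, $$|\hat x_i-x_i|\le \max\left(\frac{M_y}{\sqrt{d_i}},\ \frac{M_y^2}{4\lambda},\ \frac{2\lambda}{m_{k(i)}}+\frac{2M_y}{\sqrt{m_{k(i)}}}\right).$$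
   Context: The true signal $(x_i)_{i=1}^n\in\mathbb{R}^n$ is deterministic and piecewise constant with $K$ pieces: there are integers $1=n_1<n_2<\dots<n_K<n$, with $n_{K+1}=n+1$, such that $x_{n_k}=x_{n_k+1}=\dots=x_{n_{k+1}-1}$ for each $1\le k\le K$. In the optimization problem the symbols $x_i$ denote the optimization variables; in the bound $x_i$ denotes the true signal. The objective is strictly convex, so the minimizer $(\hat x_i)$ is unique. *)

theory Defs
  imports "HOL-Probability.Probability"
begin

text \<open>
  A vector in \<open>\<real>\<^sup>n\<close> is represented by a function \<open>nat \<Rightarrow> real\<close> of which only the values at
  \<open>1, \<dots>, n\<close> matter.  The breakpoints \<open>n\<^sub>1 < \<dots> < n\<^sub>K\<^sub>+\<^sub>1\<close> are the values \<open>b 1, \<dots>, b (K + 1)\<close>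
  of a function \<open>b\<close>.
\<close>

definition breakpoints :: "nat \<Rightarrow> nat \<Rightarrow> (nat \<Rightarrow> nat) \<Rightarrow> bool" where
  "breakpoints n K b \<longleftrightarrow>
     1 \<le> K \<and> b 1 = 1 \<and> strict_mono_on {1..K} b \<and> b K < n \<and> b (K + 1) = n + 1"

text \<open>Adjacent pieces are allowed to have the same level.\<close>

definition constant_on_pieces :: "nat \<Rightarrow> (nat \<Rightarrow> nat) \<Rightarrow> (nat \<Rightarrow> real) \<Rightarrow> bool" where
  "constant_on_pieces K b x \<longleftrightarrow>
     (\<forall>k\<in>{1..K}. \<forall>i\<in>{b k..<b (k + 1)}. x i = x (b k))"

definition piece_length :: "(nat \<Rightarrow> nat) \<Rightarrow> nat \<Rightarrow> nat" where
  "piece_length b k = b (k + 1) - b k"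

definition piece_index :: "nat \<Rightarrow> (nat \<Rightarrow> nat) \<Rightarrow> nat \<Rightarrow> nat" where
  "piece_index K b i = (THE k. k \<in> {1..K} \<and> b k \<le> i \<and> i \<le> b (k + 1) - 1)"

definition boundary_dist :: "nat \<Rightarrow> (nat \<Rightarrow> nat) \<Rightarrow> nat \<Rightarrow> nat" where
  "boundary_dist K b i =
     min (i + 1 - b (piece_index K b i)) (b (piece_index K b i + 1) - i)"

definition tv_objective :: "nat \<Rightarrow> real \<Rightarrow> (nat \<Rightarrow> real) \<Rightarrow> (nat \<Rightarrow> real) \<Rightarrow> real" where
  "tv_objective n lam y z =
     (\<Sum>i=1..n. (z i - y i)\<^sup>2) + lam * (\<Sum>i=1..n-1. \<bar>z i - z (i + 1)\<bar>)"

text \<open>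
  As the objective only depends on \<open>z 1, \<dots>, z n\<close>, minimising over all \<open>z :: nat \<Rightarrow> real\<close> is
  minimising over \<open>\<real>\<^sup>n\<close>; the minimiser is unique up to its values outside \<open>{1..n}\<close>.
\<close>

definition tv_minimizer :: "nat \<Rightarrow> real \<Rightarrow> (nat \<Rightarrow> real) \<Rightarrow> (nat \<Rightarrow> real) \<Rightarrow> bool" where
  "tv_minimizer n lam y z \<longleftrightarrow> is_arg_min (tv_objective n lam y) (\<lambda>_. True) z"

end

theory Submission
  imports Defs
begin

text \<open>
  Fix an outcome of the noise and let \<open>z\<close> be the minimiser.  Lowering \<open>z\<close> by a small amount on an
  interval of indices \<open>{p..q}\<close> cannot decrease the objective.  To first order, such a move changes
  the total variation term only at the two ends of the interval: an end gives a gain if \<open>z\<close> drops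
  strictly when leaving the interval there, and costs at most the same amount otherwise.  Hence
  \<open>2 * (\<Sum>j=p..q. z j - y j)\<close> is at most \<open>lam * (l + r)\<close> with \<open>l, r \<in> {-1, 1}\<close> and the value \<open>-1\<close>
  at every end with a strict drop (\<open>tv_minimizer_interval_sum_le\<close>).

  Suppose that every sum of \<open>L\<close> consecutive noise values is at most \<open>M * sqrt L\<close> in modulus, and
  let \<open>x\<close> have the value \<open>c\<close> on the piece containing \<open>i\<close>.  Take the longest interval around \<open>i\<close>
  inside this piece on which \<open>z \<ge> z i\<close>, and let \<open>L\<close> be its length.  Summing over it gives
  \<open>L * (z i - c) \<le> lam * (l + r) / 2 + M * sqrt L\<close>, and by maximality there is a strict drop at
  every end that is not an end of the piece.  The three terms of the bound are the three
  possibilities (\<open>upward_deviation_le\<close>):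
  \<^item> the interval reaches neither end of the piece: \<open>z i - c \<le> M / sqrt L - lam / L\<close>, a quadratic
    polynomial in \<open>1 / sqrt L\<close> with maximum \<open>M\<^sup>2 / (4 * lam)\<close>;
  \<^item> it reaches exactly one end: the penalty terms cancel or help, and \<open>L\<close> is at least the distance
    from \<open>i\<close> to that end, so \<open>z i - c \<le> M / sqrt d\<close>;
  \<^item> it is the whole piece, of length \<open>m\<close>: \<open>z i - c \<le> lam / m + M / sqrt m\<close>, which is
    half of the third term.

  Negating \<open>y\<close> and \<open>z\<close> turns this into the bound from below.

  For the probability, a noise sum over \<open>L\<close> indices is centred normal with variance \<open>L * \<sigma>\<^sup>2\<close>, and
  exceeds \<open>M_y * sqrt L\<close> in modulus with probability at most
  \<open>exp (- M_y\<^sup>2 / (2 * \<sigma>\<^sup>2)) = 1 / (n * t)\<^sup>2\<close>.  A union bound over the at most \<open>n\<^sup>2\<close> intervals gives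
  \<open>1 / t\<^sup>2\<close> (\<open>all_interval_noise_bounded\<close>).  The event in the theorem also has to be measurable; this
  holds because strong convexity makes the minimiser a Lipschitz function of the data
  (\<open>tv_minimizer_measurable\<close>).
\<close>

section \<open>Optimality of the total variation minimiser\<close>

lemma tv_minimizer_le:
  "tv_minimizer n lam y z \<Longrightarrow> tv_objective n lam y z \<le> tv_objective n lam y v"
  unfolding tv_minimizer_def is_arg_min_def by (auto simp: not_less)

lemma tv_objective_uminus:
  "tv_objective n lam (\<lambda>i. - y i) (\<lambda>i. - z i) = tv_objective n lam y z"
proof -
  have "(\<lambda>i. (- z i - - y i)\<^sup>2) = (\<lambda>i. (z i - y i)\<^sup>2)"
    by (auto simp: fun_eq_iff power2_commute)
  moreover have "(\<lambda>i. \<bar>- z i - - z (i + 1)\<bar>) = (\<lambda>i. \<bar>z i - z (i + 1)\<bar>)"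
    by (auto simp: fun_eq_iff)
  ultimately show ?thesis unfolding tv_objective_def by metis
qed

lemma tv_minimizer_uminus:
  assumes "tv_minimizer n lam y z"
  shows "tv_minimizer n lam (\<lambda>i. - y i) (\<lambda>i. - z i)"
proof -
  have "tv_objective n lam (\<lambda>i. - y i) (\<lambda>i. - z i) \<le> tv_objective n lam (\<lambda>i. - y i) v" for v
    using tv_minimizer_le[OF assms, of "\<lambda>i. - v i"] tv_objective_uminus[of n lam y z]
      tv_objective_uminus[of n lam y "\<lambda>i. - v i"] by simp
  then show ?thesis unfolding tv_minimizer_def is_arg_min_def by (auto simp: not_less)
qed

text \<open>
  The first-order optimality condition in the direction of minus the indicator of \<open>{p..q}\<close>.  It is
  obtained from an explicit perturbation, so that no subgradients are involved: if the step
  \<open>h\<close> does not exceed the size of a strict drop at an end of the interval, the absolute value at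
  that end decreases by exactly \<open>h\<close>; in all other cases it increases by at most \<open>h\<close>.  An end of the
  interval which is also an end of \<open>{1..n}\<close> contributes nothing to the total variation, and is
  covered by the coefficient \<open>1\<close>.
\<close>

lemma tv_minimizer_interval_sum_le:
  fixes z y :: "nat \<Rightarrow> real"
  assumes min: "tv_minimizer n lam y z" and lam: "lam > 0"
    and pq: "1 \<le> p" "p \<le> q" "q \<le> n"
  shows "2 * (\<Sum>j=p..q. z j - y j) \<le>
    lam * ((if 1 < p \<and> z (p - 1) < z p then -1 else 1) + (if q < n \<and> z (q + 1) < z q then -1 else 1))"
proof -
  define l :: real where "l = (if 1 < p \<and> z (p - 1) < z p then -1 else 1)"
  define r :: real where "r = (if q < n \<and> z (q + 1) < z q then -1 else 1)"
  \<comment> \<open>The largest step that does not overshoot a strict drop.\<close>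
  define h0 where "h0 = min (if l = -1 then z p - z (p - 1) else 1) (if r = -1 then z q - z (q + 1) else 1)"
  have "h0 > 0" unfolding h0_def l_def r_def by auto
  define S where "S = (\<Sum>j=p..q. z j - y j)"
  have key: "2 * S - lam * (l + r) \<le> h * real (q + 1 - p)" if h: "0 < h" "h \<le> h0" for h
  proof -
    define v where "v j = z j - (if j \<in> {p..q} then h else 0)" for j
    have "(\<Sum>j=1..n. (v j - y j)\<^sup>2) =
      (\<Sum>j=1..n. (z j - y j)\<^sup>2 + (if j \<in> {p..q} then h\<^sup>2 - 2 * h * (z j - y j) else 0))"
      by (intro sum.cong) (auto simp: v_def power2_eq_square algebra_simps)
    also have "\<dots> = (\<Sum>j=1..n. (z j - y j)\<^sup>2) + (\<Sum>j\<in>{p..q}. h\<^sup>2 - 2 * h * (z j - y j))"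
    proof -
      have "{1..n} \<inter> {p..q} = {p..q}" using pq by auto
      then show ?thesis
        by (simp only: sum.distrib sum.inter_restrict[OF finite_atLeastAtMost, symmetric])
    qed
    also have "(\<Sum>j\<in>{p..q}. h\<^sup>2 - 2 * h * (z j - y j)) = real (q + 1 - p) * h\<^sup>2 - 2 * h * S"
      by (simp add: sum_subtractf S_def flip: sum_distrib_left)
    finally have A: "(\<Sum>j=1..n. (v j - y j)\<^sup>2) =
      (\<Sum>j=1..n. (z j - y j)\<^sup>2) + (real (q + 1 - p) * h\<^sup>2 - 2 * h * S)" .
    have "(\<Sum>j=1..n-1. \<bar>v j - v (j + 1)\<bar>) \<le>
      (\<Sum>j=1..n-1. \<bar>z j - z (j + 1)\<bar> + (if j = p - 1 then h * l else 0) + (if j = q then h * r else 0))"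
    proof (rule sum_mono)
      fix j assume j: "j \<in> {1..n-1}"
      consider "j = p - 1" | "j = q" | "j \<noteq> p - 1" "j \<noteq> q" by blast
      then show "\<bar>v j - v (j + 1)\<bar> \<le>
        \<bar>z j - z (j + 1)\<bar> + (if j = p - 1 then h * l else 0) + (if j = q then h * r else 0)"
      proof cases
        case 1
        then have e: "j + 1 = p" "j \<noteq> q" "1 < p" using j pq by auto
        then have "v j = z j" "v (j + 1) = z p - h" using pq by (auto simp: v_def)
        moreover have "l = -1 \<Longrightarrow> h \<le> z p - z j \<and> z j < z p"
          using h e by (auto simp: h0_def l_def split: if_splits)
        moreover have "l = 1 \<or> l = -1" by (auto simp: l_def)
        ultimately show ?thesis using e h by auto
      next
        case 2
        then have e: "j \<noteq> p - 1" "q < n" using j pq by auto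
        then have "v j = z q - h" "v (j + 1) = z (q + 1)" using 2 pq by (auto simp: v_def)
        moreover have "r = -1 \<Longrightarrow> h \<le> z q - z (q + 1) \<and> z (q + 1) < z q"
          using h by (auto simp: h0_def r_def split: if_splits)
        moreover have "r = 1 \<or> r = -1" by (auto simp: r_def)
        ultimately show ?thesis using e h 2 by auto
      next
        case 3
        then have "j \<in> {p..q} \<longleftrightarrow> j + 1 \<in> {p..q}" using j pq by auto
        then show ?thesis using 3 by (auto simp: v_def)
      qed
    qed
    also have "\<dots> = (\<Sum>j=1..n-1. \<bar>z j - z (j + 1)\<bar>)
        + (if p - 1 \<in> {1..n-1} then h * l else 0) + (if q \<in> {1..n-1} then h * r else 0)"
      by (simp add: sum.distrib)
    also have "(if p - 1 \<in> {1..n-1} then h * l else 0) \<le> h * l"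
      using h pq by (auto simp: l_def)
    also have "(if q \<in> {1..n-1} then h * r else 0) \<le> h * r"
      using h pq by (auto simp: r_def)
    finally have B: "(\<Sum>j=1..n-1. \<bar>v j - v (j + 1)\<bar>) \<le> (\<Sum>j=1..n-1. \<bar>z j - z (j + 1)\<bar>) + h * l + h * r"
      by simp
    have "tv_objective n lam y z \<le> tv_objective n lam y v" by (rule tv_minimizer_le[OF min])
    also have "\<dots> \<le> tv_objective n lam y z + (real (q + 1 - p) * h\<^sup>2 - 2 * h * S) + lam * (h * l + h * r)"
      using A mult_left_mono[OF B, of lam] lam by (simp add: tv_objective_def algebra_simps)
    finally have "h * (2 * S - lam * (l + r)) \<le> h * (h * real (q + 1 - p))"
      by (simp add: algebra_simps power2_eq_square)
    then show ?thesis using h by simp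
  qed
  \<comment> \<open>The quadratic term of the objective is removed by letting the step tend to \<open>0\<close>.\<close>
  have "2 * S - lam * (l + r) \<le> 0"
  proof (rule ccontr)
    define L where "L = real (q + 1 - p)"
    define D where "D = 2 * S - lam * (l + r)"
    assume "\<not> ?thesis"
    then have D: "D > 0" by (simp add: D_def)
    have L: "L > 0" using pq by (simp add: L_def)
    define h where "h = min h0 (D / (2 * L))"
    have "D \<le> h * L" using key[of h] \<open>h0 > 0\<close> D L by (simp add: h_def D_def L_def)
    also have "\<dots> \<le> D / (2 * L) * L" using L by (intro mult_right_mono) (auto simp: h_def)
    finally show False using D L by simp
  qed
  then show ?thesis by (simp add: S_def l_def r_def)
qed

section \<open>The deterministic error bound\<close>

lemma maximal_run_left:
  fixes i s :: nat
  assumes "s \<le> i" "P i"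
  obtains p where "s \<le> p" "p \<le> i" "\<And>j. p \<le> j \<Longrightarrow> j \<le> i \<Longrightarrow> P j" "p = s \<or> s < p \<and> \<not> P (p - 1)"
proof -
  define Q where "Q p \<longleftrightarrow> s \<le> p \<and> p \<le> i \<and> (\<forall>j. p \<le> j \<longrightarrow> j \<le> i \<longrightarrow> P j)" for p
  define p where "p = (LEAST p. Q p)"
  have "Q i" using assms by (auto simp: Q_def)
  then have Qp: "Q p" unfolding p_def by (rule LeastI)
  moreover have "p = s \<or> s < p \<and> \<not> P (p - 1)"
  proof (rule ccontr)
    assume c: "\<not> ?thesis"
    then have "s < p" "P (p - 1)" using Qp by (auto simp: Q_def)
    moreover have "j = p - 1 \<or> p \<le> j" if "p - 1 \<le> j" for j using that by linarith
    ultimately have "Q (p - 1)" using Qp unfolding Q_def by fastforce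
    then have "p \<le> p - 1" unfolding p_def by (rule Least_le)
    then show False using \<open>s < p\<close> by simp
  qed
  ultimately show ?thesis using that by (auto simp: Q_def)
qed

text \<open>
  The reflection \<open>j \<mapsto> e - j\<close> of the run to the left.
\<close>

lemma maximal_run_right:
  fixes i e :: nat
  assumes "i \<le> e" "P i"
  obtains q where "i \<le> q" "q \<le> e" "\<And>j. i \<le> j \<Longrightarrow> j \<le> q \<Longrightarrow> P j" "q = e \<or> q < e \<and> \<not> P (q + 1)"
proof -
  obtain p where p: "0 \<le> p" "p \<le> e - i" "\<And>j. p \<le> j \<Longrightarrow> j \<le> e - i \<Longrightarrow> P (e - j)"
    "p = 0 \<or> 0 < p \<and> \<not> P (e - (p - 1))"
    using maximal_run_left[of 0 "e - i" "\<lambda>j. P (e - j)"] assms by auto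
  show ?thesis
  proof (rule that[of "e - p"])
    show "P j" if "i \<le> j" "j \<le> e - p" for j
      using p(3)[of "e - j"] that p(2) assms by auto
    show "e - p = e \<or> e - p < e \<and> \<not> P (e - p + 1)"
      using p(2,4) assms by (auto simp: Suc_diff_le)
  qed (use p assms in auto)
qed

text \<open>
  The core of the error bound.  The sum of \<open>z j - c\<close> over the longest interval around \<open>i\<close> in
  \<open>{s..e}\<close> on which \<open>z \<ge> z i\<close> is at least its length times \<open>z i - c\<close>, while optimality and the noise
  hypothesis bound it from above.  The boundary coefficient is \<open>-1\<close> at every end of the
  interval that is not an end of \<open>{s..e}\<close>, since \<open>z\<close> falls strictly below \<open>z i\<close> just outside.
\<close>

lemma upward_deviation_le:
  fixes z y :: "nat \<Rightarrow> real"
  assumes min: "tv_minimizer n lam y z" and lam: "lam > 0" and M: "M \<ge> 0"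
    and rng: "1 \<le> s" "s \<le> i" "i \<le> e" "e \<le> n"
    and noise: "\<And>p q. s \<le> p \<Longrightarrow> p \<le> q \<Longrightarrow> q \<le> e \<Longrightarrow>
      (\<Sum>j=p..q. y j - c) \<le> M * sqrt (real (q + 1 - p))"
  shows "z i - c \<le> max (M / sqrt (real (min (i + 1 - s) (e + 1 - i))))
    (max (M\<^sup>2 / (4 * lam)) (lam / real (e + 1 - s) + M / sqrt (real (e + 1 - s))))"
proof -
  obtain p where p: "s \<le> p" "p \<le> i" "\<And>j. p \<le> j \<Longrightarrow> j \<le> i \<Longrightarrow> z i \<le> z j"
    "p = s \<or> s < p \<and> \<not> z i \<le> z (p - 1)"
    using maximal_run_left[of s i "\<lambda>j. z i \<le> z j"] rng by auto
  obtain q where q: "i \<le> q" "q \<le> e" "\<And>j. i \<le> j \<Longrightarrow> j \<le> q \<Longrightarrow> z i \<le> z j"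
    "q = e \<or> q < e \<and> \<not> z i \<le> z (q + 1)"
    using maximal_run_right[of i e "\<lambda>j. z i \<le> z j"] rng by auto
  define L where "L = real (q + 1 - p)"
  have L: "L > 0" using p q by (simp add: L_def)
  define l :: real where "l = (if 1 < p \<and> z (p - 1) < z p then -1 else 1)"
  define r :: real where "r = (if q < n \<and> z (q + 1) < z q then -1 else 1)"
  have l: "l \<le> 1" "s < p \<Longrightarrow> l = -1" using p(2,4) p(3)[of p] rng by (auto simp: l_def)
  have r: "r \<le> 1" "q < e \<Longrightarrow> r = -1" using q(1,4) q(3)[of q] rng by (auto simp: r_def)
  have "L * (z i - c) = (\<Sum>j=p..q. z i - c)" by (simp add: L_def)
  also have "\<dots> \<le> (\<Sum>j=p..q. (z j - y j) + (y j - c))"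
  proof (rule sum_mono)
    fix j assume "j \<in> {p..q}"
    then have "z i \<le> z j" using p(3)[of j] q(3)[of j] by (cases "j \<le> i") auto
    then show "z i - c \<le> (z j - y j) + (y j - c)" by simp
  qed
  also have "\<dots> = (\<Sum>j=p..q. z j - y j) + (\<Sum>j=p..q. y j - c)" by (rule sum.distrib)
  also have "(\<Sum>j=p..q. z j - y j) \<le> lam * (l + r) / 2"
    using tv_minimizer_interval_sum_le[OF min lam, of p q] p q rng by (simp add: l_def r_def)
  also have "(\<Sum>j=p..q. y j - c) \<le> M * sqrt L"
    using noise[of p q] p q by (simp add: L_def)
  finally have "L * (z i - c) \<le> lam * (l + r) / 2 + M * sqrt L" by simp
  then have "z i - c \<le> (lam * (l + r) / 2 + M * sqrt L) / L"
    using L by (simp add: pos_le_divide_eq mult.commute)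
  also have "\<dots> = lam * (l + r) / 2 / L + M / sqrt L"
  proof -
    have "M * sqrt L / L = M * (sqrt L / L)" by (rule times_divide_eq_right[symmetric])
    also have "sqrt L / L = inverse (sqrt L)" using L by (intro sqrt_divide_self_eq) simp
    finally show ?thesis by (simp only: add_divide_distrib divide_inverse[of M])
  qed
  finally have dev: "z i - c \<le> lam * (l + r) / 2 / L + M / sqrt L" .
  \<comment> \<open>The run ends with a strict drop on one side, so the penalties at its ends sum to at most \<open>0\<close>;
    on the other side it fills the whole segment between \<open>i\<close> and an end of \<open>{s..e}\<close>.\<close>
  have touching: ?thesis if "l + r \<le> 0" "p = s \<or> q = e"
  proof -
    define d where "d = min (i + 1 - s) (e + 1 - i)"
    have d: "0 < real d" "real d \<le> L" using that(2) p q rng by (auto simp: d_def L_def)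
    have "lam * (l + r) \<le> 0" using that(1) lam by (intro mult_nonneg_nonpos) auto
    then have "lam * (l + r) / 2 / L \<le> 0" using L by (simp add: divide_nonpos_pos)
    moreover have "M / sqrt L \<le> M / sqrt (real d)"
      using d M by (intro divide_left_mono mult_pos_pos) auto
    ultimately have "z i - c \<le> M / sqrt (real d)" using dev by linarith
    then show ?thesis unfolding le_max_iff_disj d_def by blast
  qed
  consider "s < p" "q < e" | "p = s" "q = e" | "p = s" "q < e" | "s < p" "q = e"
    using p(4) q(4) by blast
  then show ?thesis
  proof cases
    case 1
    \<comment> \<open>A strict drop at both ends: the bound is a quadratic polynomial in \<open>1 / sqrt L\<close>.\<close>
    define u where "u = 1 / sqrt L"
    have "u\<^sup>2 = 1 / L" using L by (simp add: u_def power_divide)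
    then have "z i - c \<le> M * u - lam * u\<^sup>2"
      using dev l(2) r(2) 1 by (simp add: u_def)
    also have "\<dots> \<le> M\<^sup>2 / (4 * lam)"
    proof -
      have "0 \<le> (M - 2 * lam * u)\<^sup>2" by simp
      then have "(M * u - lam * u\<^sup>2) * (4 * lam) \<le> M\<^sup>2"
        by (simp add: power2_eq_square algebra_simps)
      then show ?thesis using lam by (simp add: pos_le_divide_eq)
    qed
    finally show ?thesis unfolding le_max_iff_disj by blast
  next
    case 2
    then have L': "L = real (e + 1 - s)" by (simp add: L_def)
    have "lam * (l + r) \<le> lam * 2" using l(1) r(1) lam by (intro mult_left_mono) auto
    then have "lam * (l + r) / 2 / L \<le> lam / L" using L by (intro divide_right_mono) auto
    then have "z i - c \<le> lam / L + M / sqrt L" using dev by linarith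
    then show ?thesis unfolding le_max_iff_disj L' by blast
  next
    case 3
    then show ?thesis using touching l r by auto
  next
    case 4
    then show ?thesis using touching l r by auto
  qed
qed

lemma abs_deviation_le:
  fixes z y :: "nat \<Rightarrow> real"
  assumes min: "tv_minimizer n lam y z" and lam: "lam > 0" and M: "M \<ge> 0"
    and rng: "1 \<le> s" "s \<le> i" "i \<le> e" "e \<le> n"
    and noise: "\<And>p q. s \<le> p \<Longrightarrow> p \<le> q \<Longrightarrow> q \<le> e \<Longrightarrow>
      \<bar>\<Sum>j=p..q. y j - c\<bar> \<le> M * sqrt (real (q + 1 - p))"
  shows "\<bar>z i - c\<bar> \<le> max (M / sqrt (real (min (i + 1 - s) (e + 1 - i))))
    (max (M\<^sup>2 / (4 * lam)) (lam / real (e + 1 - s) + M / sqrt (real (e + 1 - s))))"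
proof -
  define R where "R = max (M / sqrt (real (min (i + 1 - s) (e + 1 - i))))
    (max (M\<^sup>2 / (4 * lam)) (lam / real (e + 1 - s) + M / sqrt (real (e + 1 - s))))"
  have neg: "(\<Sum>j=p..q. - y j - - c) = - (\<Sum>j=p..q. y j - c)" for p q
    by (simp add: sum_negf[symmetric])
  have "z i - c \<le> R"
    unfolding R_def
    by (rule upward_deviation_le[OF min lam M rng]) (use noise in fastforce)
  moreover have "- z i - - c \<le> R"
    unfolding R_def
    by (rule upward_deviation_le[OF tv_minimizer_uminus[OF min] lam M rng])
      (unfold neg, use noise in fastforce)
  ultimately show ?thesis unfolding R_def[symmetric] by linarith
qed

section \<open>Measurability of the minimiser\<close>

text \<open>
  Strong convexity, used at the midpoint \<open>w\<close> of \<open>z\<close> and \<open>v\<close>: the parallelogram law gives the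
  quadratic part of the objective at \<open>w\<close> an extra \<open>- \<parallel>z - v\<parallel>\<^sup>2 / 4\<close> below the average of its values
  at \<open>z\<close> and \<open>v\<close>, and the total variation is convex.
\<close>

lemma tv_minimizer_quadratic_growth:
  assumes min: "tv_minimizer n lam y z" and lam: "lam > 0"
  shows "tv_objective n lam y z + (\<Sum>j=1..n. (z j - v j)\<^sup>2) / 2 \<le> tv_objective n lam y v"
proof -
  define D where "D = (\<Sum>j=1..n. (z j - v j)\<^sup>2)"
  define w where "w j = (z j + v j) / 2" for j
  have "(\<Sum>j=1..n-1. \<bar>w j - w (j + 1)\<bar>)
    \<le> (\<Sum>j=1..n-1. (\<bar>z j - z (j + 1)\<bar> + \<bar>v j - v (j + 1)\<bar>) / 2)"
    by (intro sum_mono) (auto simp: w_def abs_if field_simps)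
  also have "\<dots> = ((\<Sum>j=1..n-1. \<bar>z j - z (j + 1)\<bar>) + (\<Sum>j=1..n-1. \<bar>v j - v (j + 1)\<bar>)) / 2"
    by (simp add: sum_divide_distrib[symmetric] sum.distrib)
  finally have A: "(\<Sum>j=1..n-1. \<bar>w j - w (j + 1)\<bar>) \<le> \<dots>" .
  have "(\<Sum>j=1..n. (w j - y j)\<^sup>2)
    = (\<Sum>j=1..n. ((z j - y j)\<^sup>2 + (v j - y j)\<^sup>2) / 2 - (z j - v j)\<^sup>2 / 4)"
    by (intro sum.cong) (auto simp: w_def power2_eq_square field_simps)
  also have "\<dots> = ((\<Sum>j=1..n. (z j - y j)\<^sup>2) + (\<Sum>j=1..n. (v j - y j)\<^sup>2)) / 2
      - D / 4"
    by (simp add: sum_divide_distrib[symmetric] sum.distrib sum_subtractf D_def)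
  finally have B: "(\<Sum>j=1..n. (w j - y j)\<^sup>2) = \<dots>" .
  have "tv_objective n lam y z \<le> tv_objective n lam y w" by (rule tv_minimizer_le[OF min])
  also have "\<dots> \<le> (tv_objective n lam y z + tv_objective n lam y v) / 2
      - D / 4"
    using mult_left_mono[OF A, of lam] lam unfolding tv_objective_def B by (simp add: field_simps)
  finally show ?thesis unfolding D_def[symmetric] by (simp add: field_simps)
qed

text \<open>
  Quadratic growth at both minimisers, each compared with the other one, bounds \<open>\<parallel>z - z'\<parallel>\<^sup>2\<close> by
  twice the inner product of \<open>z - z'\<close> and \<open>y - y'\<close>; the total variation terms cancel.  For
  \<open>y = y'\<close> this is uniqueness of the minimiser on \<open>{1..n}\<close>.
\<close>

lemma tv_minimizer_lipschitz:
  assumes z: "tv_minimizer n lam y z" and z': "tv_minimizer n lam y' z'" and lam: "lam > 0"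
  shows "(\<Sum>j=1..n. (z j - z' j)\<^sup>2) \<le> 4 * (\<Sum>j=1..n. (y j - y' j)\<^sup>2)"
proof -
  define D where "D = (\<Sum>j=1..n. (z j - z' j)\<^sup>2)"
  have D': "(\<Sum>j=1..n. (z' j - z j)\<^sup>2) = D" unfolding D_def by (intro sum.cong) (auto simp: power2_commute)
  have "D \<le> (\<Sum>j=1..n. (z' j - y j)\<^sup>2) - (\<Sum>j=1..n. (z j - y j)\<^sup>2)
      + (\<Sum>j=1..n. (z j - y' j)\<^sup>2) - (\<Sum>j=1..n. (z' j - y' j)\<^sup>2)"
    using tv_minimizer_quadratic_growth[OF z lam, of z'] tv_minimizer_quadratic_growth[OF z' lam, of z]
    unfolding D' D_def[symmetric] tv_objective_def by simp
  also have "\<dots> = (\<Sum>j=1..n. 2 * (z j - z' j) * (y j - y' j))"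
    unfolding sum_subtractf[symmetric] sum.distrib[symmetric]
    by (intro sum.cong) (auto simp: power2_eq_square algebra_simps)
  also have "\<dots> \<le> (\<Sum>j=1..n. (z j - z' j)\<^sup>2 / 2 + 2 * (y j - y' j)\<^sup>2)"
  proof (rule sum_mono)
    fix j
    have "2 * a * b \<le> a\<^sup>2 / 2 + 2 * b\<^sup>2" for a b :: real
      using zero_le_power2[of "a - 2 * b"] by (simp add: power2_eq_square field_simps)
    then show "2 * (z j - z' j) * (y j - y' j) \<le> (z j - z' j)\<^sup>2 / 2 + 2 * (y j - y' j)\<^sup>2" .
  qed
  also have "\<dots> = D / 2 + 2 * (\<Sum>j=1..n. (y j - y' j)\<^sup>2)"
    by (simp add: D_def sum.distrib sum_divide_distrib sum_distrib_left)
  finally show ?thesis by (simp add: D_def)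
qed

text \<open>
  By the Lipschitz estimate, if \<open>xhat \<omega> i < c\<close> then the same holds for all data in an open ball
  around \<open>y \<omega>\<close>.  The sublevel set is therefore the preimage of a union of such balls, an open set in
  the product topology, under the data.
\<close>

lemma tv_minimizer_measurable:
  fixes y xhat :: "'a \<Rightarrow> nat \<Rightarrow> real"
  assumes lam: "lam > 0" and i: "i \<in> {1..n}"
    and y: "\<And>j. j \<in> {1..n} \<Longrightarrow> (\<lambda>\<omega>. y \<omega> j) \<in> borel_measurable M"
    and min: "\<And>\<omega>. \<omega> \<in> space M \<Longrightarrow> tv_minimizer n lam (y \<omega>) (xhat \<omega>)"
  shows "(\<lambda>\<omega>. xhat \<omega> i) \<in> borel_measurable M"
proof (rule borel_measurableI_less)
  fix c :: real
  define A where "A = {\<omega>\<in>space M. xhat \<omega> i < c}"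
  \<comment> \<open>Coordinates outside \<open>{1..n}\<close> are unconstrained in \<open>y\<close>; here they are set to \<open>0\<close> so that the
    whole sequence is measurable.\<close>
  define Y where "Y \<omega> j = (if j \<in> {1..n} then y \<omega> j else 0)" for \<omega> and j :: nat
  have "Y \<in> borel_measurable M"
  proof (rule measurable_coordinatewise_then_product)
    show "(\<lambda>\<omega>. Y \<omega> j) \<in> borel_measurable M" for j
      using y[of j] by (cases "j \<in> {1..n}") (simp_all only: Y_def if_True if_False borel_measurable_const)
  qed
  define B where "B \<omega> = {v. 4 * (\<Sum>j=1..n. (v j - y \<omega> j)\<^sup>2) < (c - xhat \<omega> i)\<^sup>2}" for \<omega>
  have "open (B \<omega>)" for \<omega>
    unfolding B_def by (intro open_Collect_less continuous_intros continuous_on_product_coordinates)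
  then have "open (\<Union>\<omega>\<in>A. B \<omega>)" by auto
  then have "Y -` (\<Union>\<omega>\<in>A. B \<omega>) \<inter> space M \<in> sets M"
    using \<open>Y \<in> borel_measurable M\<close> by (intro measurable_sets) auto
  moreover have "Y -` (\<Union>\<omega>\<in>A. B \<omega>) \<inter> space M = A"
  proof (intro equalityI subsetI)
    fix \<omega> assume \<omega>: "\<omega> \<in> A"
    then have "Y \<omega> \<in> B \<omega>" by (simp add: A_def B_def Y_def)
    then show "\<omega> \<in> Y -` (\<Union>\<omega>\<in>A. B \<omega>) \<inter> space M" using \<omega> by (auto simp: A_def)
  next
    fix \<omega>' assume "\<omega>' \<in> Y -` (\<Union>\<omega>\<in>A. B \<omega>) \<inter> space M"
    then obtain \<omega> where \<omega>: "\<omega> \<in> A" "Y \<omega>' \<in> B \<omega>" and \<omega>': "\<omega>' \<in> space M" by auto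
    have "(xhat \<omega>' i - xhat \<omega> i)\<^sup>2 \<le> (\<Sum>j=1..n. (xhat \<omega>' j - xhat \<omega> j)\<^sup>2)"
      using i by (intro member_le_sum) auto
    also have "\<dots> \<le> 4 * (\<Sum>j=1..n. (y \<omega>' j - y \<omega> j)\<^sup>2)"
      using \<omega> \<omega>' by (intro tv_minimizer_lipschitz[OF min min lam]) (auto simp: A_def)
    also have "\<dots> < (c - xhat \<omega> i)\<^sup>2" using \<omega>(2) by (simp add: B_def Y_def)
    finally have "\<bar>xhat \<omega>' i - xhat \<omega> i\<bar> < \<bar>c - xhat \<omega> i\<bar>" 
      by (metis abs_le_square_iff not_le)
    then show "\<omega>' \<in> A" using \<omega> \<omega>' by (auto simp: A_def)
  qed
  ultimately show "{\<omega>\<in>space M. xhat \<omega> i < c} \<in> sets M" by (simp add: A_def)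
qed

section \<open>Gaussian noise on intervals\<close>

text \<open>
  Shifting the two tails to the origin, both are compared with the density itself:
  \<open>(a + v)\<^sup>2 \<ge> a\<^sup>2 + v\<^sup>2\<close> for \<open>v > 0\<close>, and symmetrically for the left tail, so the two shifted tails
  together have at most the total mass \<open>1\<close> times \<open>exp (- a\<^sup>2 / (2 * s\<^sup>2))\<close>.  The absence of a factor
  \<open>2\<close> in front is what lets the later union bound end with exactly \<open>1 / t\<^sup>2\<close>.
\<close>

lemma (in prob_space) normal_two_sided_tail:
  assumes X: "distributed M lborel X (normal_density 0 s)" and s: "s > 0" and a: "a \<ge> 0"
  shows "prob {\<omega>\<in>space M. a < \<bar>X \<omega>\<bar>} \<le> exp (- a\<^sup>2 / (2 * s\<^sup>2))"
proof -
  let ?f = "normal_density 0 s"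
  let ?E = "exp (- a\<^sup>2 / (2 * s\<^sup>2))"
  have shift: "?f (u + v) \<le> ?E * ?f v" if "u\<^sup>2 = a\<^sup>2" "0 \<le> u * v" for u v
  proof -
    have "?f (u + v) = 1 / sqrt (2 * pi * s\<^sup>2) * exp (- (u + v)\<^sup>2 / (2 * s\<^sup>2))"
      by (simp add: normal_density_def)
    also have "\<dots> \<le> 1 / sqrt (2 * pi * s\<^sup>2) * exp (- a\<^sup>2 / (2 * s\<^sup>2) + - v\<^sup>2 / (2 * s\<^sup>2))"
    proof (intro mult_left_mono)
      have "- (u + v)\<^sup>2 / (2 * s\<^sup>2) \<le> (- a\<^sup>2 + - v\<^sup>2) / (2 * s\<^sup>2)"
        using that by (intro divide_right_mono) (auto simp: power2_sum)
      then show "exp (- (u + v)\<^sup>2 / (2 * s\<^sup>2)) \<le> exp (- a\<^sup>2 / (2 * s\<^sup>2) + - v\<^sup>2 / (2 * s\<^sup>2))"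
        by (simp add: add_divide_distrib diff_divide_distrib)
    qed simp
    also have "\<dots> = ?E * ?f v" by (simp only: normal_density_def exp_add diff_zero) simp
    finally show ?thesis .
  qed
  have "{\<omega>\<in>space M. a < \<bar>X \<omega>\<bar>} = X -` {v. a < \<bar>v\<bar>} \<inter> space M" by auto
  then have "emeasure M {\<omega>\<in>space M. a < \<bar>X \<omega>\<bar>} = (\<integral>\<^sup>+v. ennreal (?f v) * indicator {v. a < \<bar>v\<bar>} v \<partial>lborel)"
    using distributed_emeasure[OF X, of "{v. a < \<bar>v\<bar>}"] by simp
  also have "\<dots> = (\<integral>\<^sup>+v. ennreal (?f v) * indicator {a<..} v + ennreal (?f v) * indicator {..<-a} v \<partial>lborel)"
    using a by (intro nn_integral_cong) (auto split: split_indicator)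
  also have "\<dots> = (\<integral>\<^sup>+v. ennreal (?f v) * indicator {a<..} v \<partial>lborel)
      + (\<integral>\<^sup>+v. ennreal (?f v) * indicator {..<-a} v \<partial>lborel)"
    by (rule nn_integral_add) auto
  also have "\<dots> = (\<integral>\<^sup>+v. ennreal (?f (a + v)) * indicator {a<..} (a + v) \<partial>lborel)
      + (\<integral>\<^sup>+v. ennreal (?f (- a + v)) * indicator {..<-a} (- a + v) \<partial>lborel)"
    using nn_integral_real_affine[of "\<lambda>v. ennreal (?f v) * indicator {a<..} v" 1 a]
      nn_integral_real_affine[of "\<lambda>v. ennreal (?f v) * indicator {..<-a} v" 1 "-a"] by simp
  also have "\<dots> = (\<integral>\<^sup>+v. ennreal (?f (a + v)) * indicator {a<..} (a + v)
      + ennreal (?f (- a + v)) * indicator {..<-a} (- a + v) \<partial>lborel)"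
    by (rule nn_integral_add[symmetric]) auto
  also have "\<dots> \<le> (\<integral>\<^sup>+v. ennreal ?E * ennreal (?f v) \<partial>lborel)"
    using shift[of a] shift[of "-a"] a
    by (intro nn_integral_mono)
      (auto split: split_indicator simp: ennreal_mult[symmetric] mult_nonneg_nonpos intro!: ennreal_leI)
  also have "\<dots> = ennreal ?E * (\<integral>\<^sup>+v. ennreal (?f v) \<partial>lborel)" by (rule nn_integral_cmult) auto
  also have "(\<integral>\<^sup>+v. ennreal (?f v) \<partial>lborel) = 1"
    using prob_space.emeasure_space_1[OF prob_space_normal_density[OF s, of 0]]
    by (simp add: emeasure_density)
  finally show ?thesis by (simp add: emeasure_eq_measure)
qed

lemma (in prob_space) interval_noise_tail:
  assumes indep: "indep_vars (\<lambda>_. borel) (\<lambda>i \<omega>. eps \<omega> i) {1..n}"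
    and normal: "\<And>i. i \<in> {1..n} \<Longrightarrow> distributed M lborel (\<lambda>\<omega>. eps \<omega> i) (normal_density 0 \<sigma>)"
    and \<sigma>: "\<sigma> > 0" and pq: "1 \<le> p" "p \<le> q" "q \<le> n" and a: "a \<ge> 0"
  shows "prob {\<omega>\<in>space M. a * sqrt (real (q + 1 - p)) < \<bar>\<Sum>j=p..q. eps \<omega> j\<bar>} \<le> exp (- a\<^sup>2 / (2 * \<sigma>\<^sup>2))"
proof -
  define L where "L = real (q + 1 - p)"
  have L: "L > 0" using pq by (simp add: L_def)
  have sub: "{p..q} \<subseteq> {1..n}" using pq by auto
  have "distributed M lborel (\<lambda>\<omega>. \<Sum>j\<in>{p..q}. eps \<omega> j)
      (normal_density (\<Sum>j\<in>{p..q}. 0) (sqrt (\<Sum>j\<in>{p..q}. \<sigma>\<^sup>2)))"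
    using pq sub \<sigma> normal by (intro sum_indep_normal indep_vars_subset[OF indep sub]) auto
  moreover have "(\<Sum>j\<in>{p..q}. \<sigma>\<^sup>2) = L * \<sigma>\<^sup>2" by (simp add: L_def)
  ultimately have "distributed M lborel (\<lambda>\<omega>. \<Sum>j=p..q. eps \<omega> j) (normal_density 0 (sqrt (L * \<sigma>\<^sup>2)))"
    by (simp only: sum.neutral_const)
  from normal_two_sided_tail[OF this, of "a * sqrt L"]
  have "prob {\<omega>\<in>space M. a * sqrt L < \<bar>\<Sum>j=p..q. eps \<omega> j\<bar>}
      \<le> exp (- (a * sqrt L)\<^sup>2 / (2 * (sqrt (L * \<sigma>\<^sup>2))\<^sup>2))"
    using L \<sigma> a by simp
  also have "- (a * sqrt L)\<^sup>2 / (2 * (sqrt (L * \<sigma>\<^sup>2))\<^sup>2) = - a\<^sup>2 / (2 * \<sigma>\<^sup>2)"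
    using L by (simp add: power_mult_distrib)
  finally show ?thesis by (simp add: L_def)
qed

text \<open>
  The threshold \<open>a\<close> is chosen such that a single interval fails with probability at most
  \<open>1 / (n * t)\<^sup>2\<close>, which beats the number of intervals, at most \<open>n\<^sup>2\<close>.
\<close>

lemma (in prob_space) all_interval_noise_bounded:
  assumes indep: "indep_vars (\<lambda>_. borel) (\<lambda>i \<omega>. eps \<omega> i) {1..n}"
    and normal: "\<And>i. i \<in> {1..n} \<Longrightarrow> distributed M lborel (\<lambda>\<omega>. eps \<omega> i) (normal_density 0 \<sigma>)"
    and \<sigma>: "\<sigma> > 0" and n: "n \<ge> 1" and t: "t \<ge> 1"
    and a: "a = 2 * \<sigma> * sqrt (ln (real n) + ln t)"
  shows "1 - 1 / t\<^sup>2 \<le> prob {\<omega>\<in>space M. \<forall>p\<in>{1..n}. \<forall>q\<in>{p..n}.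
    \<bar>\<Sum>j=p..q. eps \<omega> j\<bar> \<le> a * sqrt (real (q + 1 - p))}"
proof -
  have nonneg: "ln (real n) + ln t \<ge> 0" using n t by simp
  then have a0: "a \<ge> 0" using \<sigma> by (simp add: a)
  have "a\<^sup>2 = 4 * \<sigma>\<^sup>2 * (ln (real n) + ln t)" using nonneg by (simp add: a power_mult_distrib)
  then have "- a\<^sup>2 / (2 * \<sigma>\<^sup>2) = - (2 * ln (real n * t))"
    using \<sigma> n t by (simp add: ln_mult field_simps)
  then have E: "exp (- a\<^sup>2 / (2 * \<sigma>\<^sup>2)) = 1 / (real n * t)\<^sup>2"
    using n t by (simp add: exp_minus exp_double inverse_eq_divide)
  define bad where "bad = (\<lambda>(p, q). {\<omega>\<in>space M. a * sqrt (real (q + 1 - p)) < \<bar>\<Sum>j=p..q. eps \<omega> j\<bar>})"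
  define I where "I = Sigma {1..n} (\<lambda>p. {p..n})"
  have [measurable]: "(\<lambda>\<omega>. eps \<omega> j) \<in> borel_measurable M" if "j \<in> {1..n}" for j
    using distributed_measurable[OF normal[OF that]] by simp
  have m: "bad i \<in> events" if "i \<in> I" for i
  proof -
    have "(\<lambda>\<omega>. \<Sum>j=fst i..snd i. eps \<omega> j) \<in> borel_measurable M"
      using that by (intro borel_measurable_sum) (auto simp: I_def)
    then show ?thesis by (auto simp: bad_def split_beta)
  qed
  have I: "finite I" "I \<subseteq> {1..n} \<times> {1..n}" by (auto simp: I_def)
  have "card I \<le> n * n" using card_mono[OF _ I(2)] by simp
  then have cI: "real (card I) \<le> (real n)\<^sup>2" by (metis of_nat_le_iff of_nat_mult power2_eq_square)
  have "prob (\<Union>i\<in>I. bad i) \<le> (\<Sum>i\<in>I. prob (bad i))"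
    using m I by (intro finite_measure_subadditive_finite) auto
  also have "\<dots> \<le> (\<Sum>i\<in>I. 1 / (real n * t)\<^sup>2)"
    unfolding E[symmetric] using interval_noise_tail[OF indep normal \<sigma> _ _ _ a0]
    by (intro sum_mono) (auto simp: I_def bad_def)
  also have "\<dots> = real (card I) / (real n * t)\<^sup>2" by simp
  also have "\<dots> \<le> (real n)\<^sup>2 / (real n * t)\<^sup>2" by (intro divide_right_mono cI) simp
  also have "\<dots> = 1 / t\<^sup>2" using n by (simp add: power_mult_distrib)
  finally have "1 - 1 / t\<^sup>2 \<le> 1 - prob (\<Union>i\<in>I. bad i)" by simp
  also have "\<dots> = prob (space M - (\<Union>i\<in>I. bad i))"
    using m I by (intro prob_compl[symmetric] sets.finite_UN) auto
  also have "space M - (\<Union>i\<in>I. bad i) = {\<omega>\<in>space M. \<forall>p\<in>{1..n}. \<forall>q\<in>{p..n}.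
    \<bar>\<Sum>j=p..q. eps \<omega> j\<bar> \<le> a * sqrt (real (q + 1 - p))}"
    unfolding I_def bad_def by (rule set_eqI) (simp add: not_less del: of_nat_diff, blast)
  finally show ?thesis .
qed

section \<open>The error bound for piecewise constant signals\<close>

text \<open>
  The definition of breakpoints asks for monotonicity only up to \<open>K\<close>; the last breakpoint
  \<open>n + 1\<close> continues it because \<open>b K < n\<close>.
\<close>

lemma breakpoints_less_mono:
  assumes "breakpoints n K b" "1 \<le> k" "k < k'" "k' \<le> K + 1"
  shows "b k < b k'"
proof (cases "k' \<le> K")
  case True
  then show ?thesis using assms by (auto simp: breakpoints_def intro: strict_mono_onD)
next
  case False
  have "b k \<le> b K" using assms False strict_mono_onD[of "{1..K}" b k K]
    by (cases "k = K") (auto simp: breakpoints_def)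
  then show ?thesis using assms False by (auto simp: breakpoints_def le_Suc_eq)
qed

text \<open>
  The piece of \<open>i\<close> starts at the last breakpoint that is not after \<open>i\<close>; two pieces containing \<open>i\<close>
  would contradict the ordering of the breakpoints.
\<close>

lemma piece_index_props:
  assumes b: "breakpoints n K b" and i: "i \<in> {1..n}"
  shows "piece_index K b i \<in> {1..K}" "b (piece_index K b i) \<le> i" "i < b (piece_index K b i + 1)"
proof -
  let ?P = "\<lambda>k. k \<in> {1..K} \<and> b k \<le> i \<and> i \<le> b (k + 1) - 1"
  define k where "k = Max {k\<in>{1..K}. b k \<le> i}"
  have fin: "finite {k\<in>{1..K}. b k \<le> i}" by simp
  have "1 \<in> {k\<in>{1..K}. b k \<le> i}" using b i by (auto simp: breakpoints_def)
  then have "k \<in> {k\<in>{1..K}. b k \<le> i}" using Max_in[OF fin] unfolding k_def by blast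
  then have k: "k \<in> {1..K}" "b k \<le> i" by auto
  have "i < b (k + 1)"
  proof (rule ccontr)
    assume c: "\<not> i < b (k + 1)"
    have "k \<noteq> K" using c b i by (auto simp: breakpoints_def)
    then have "k + 1 \<le> k" using c k Max_ge[OF fin, of "k + 1"] unfolding k_def[symmetric] by auto
    then show False by simp
  qed
  then have "?P k" using k by auto
  moreover have "k' = k" if k': "?P k'" for k'
  proof (rule ccontr)
    have less: "i < b (k' + 1)" using k' breakpoints_less_mono[OF b, of k' "k' + 1"] by auto
    assume "k' \<noteq> k"
    then consider "k' < k" | "k < k'" by linarith
    then show False
    proof cases
      case 1
      then have "b (k' + 1) \<le> b k" using breakpoints_less_mono[OF b, of "k' + 1" k] k k'
        by (cases "k' + 1 = k") auto
      then show False using less k by simp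
    next
      case 2
      then have "b (k + 1) \<le> b k'" using breakpoints_less_mono[OF b, of "k + 1" k'] k k'
        by (cases "k + 1 = k'") auto
      then show False using \<open>i < b (k + 1)\<close> k' by simp
    qed
  qed
  ultimately have "piece_index K b i = k" unfolding piece_index_def by (rule the_equality)
  then show "piece_index K b i \<in> {1..K}" "b (piece_index K b i) \<le> i" "i < b (piece_index K b i + 1)"
    using k \<open>i < b (k + 1)\<close> by auto
qed

text \<open>
  On the piece containing \<open>i\<close> the differences \<open>y j - x i\<close> are the noise, so the error bound on a
  constant segment applies with that piece as the segment.
\<close>

lemma piecewise_constant_deviation_le:
  fixes z y x \<delta> :: "nat \<Rightarrow> real"
  assumes min: "tv_minimizer n lam y z" and lam: "lam > 0" and M: "M \<ge> 0"
    and b: "breakpoints n K b" and x: "constant_on_pieces K b x"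
    and y: "\<And>j. j \<in> {1..n} \<Longrightarrow> y j = x j + \<delta> j"
    and noise: "\<And>p q. 1 \<le> p \<Longrightarrow> p \<le> q \<Longrightarrow> q \<le> n \<Longrightarrow>
      \<bar>\<Sum>j=p..q. \<delta> j\<bar> \<le> M * sqrt (real (q + 1 - p))"
    and i: "i \<in> {1..n}"
  shows "\<bar>z i - x i\<bar> \<le> Max {M / sqrt (real (boundary_dist K b i)), M\<^sup>2 / (4 * lam),
    2 * lam / real (piece_length b (piece_index K b i))
      + 2 * M / sqrt (real (piece_length b (piece_index K b i)))}"
proof -
  define k where "k = piece_index K b i"
  have k: "k \<in> {1..K}" "b k \<le> i" "i < b (k + 1)"
    using piece_index_props[OF b i] by (auto simp: k_def)
  have bk: "1 \<le> b k" using breakpoints_less_mono[OF b, of 1 k] b k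
    by (cases "k = 1") (auto simp: breakpoints_def)
  have bk1: "b (k + 1) \<le> n + 1" using breakpoints_less_mono[OF b, of "k + 1" "K + 1"] b k
    by (cases "k = K") (auto simp: breakpoints_def)
  have xc: "x j = x i" if "b k \<le> j" "j < b (k + 1)" for j
    using x k that unfolding constant_on_pieces_def by (metis atLeastLessThan_iff)
  have "\<bar>z i - x i\<bar> \<le> max (M / sqrt (real (min (i + 1 - b k) (b (k + 1) - 1 + 1 - i))))
    (max (M\<^sup>2 / (4 * lam)) (lam / real (b (k + 1) - 1 + 1 - b k) + M / sqrt (real (b (k + 1) - 1 + 1 - b k))))"
  proof (rule abs_deviation_le[OF min lam M])
    fix p q assume pq: "b k \<le> p" "p \<le> q" "q \<le> b (k + 1) - 1"
    have "(\<Sum>j=p..q. y j - x i) = (\<Sum>j=p..q. \<delta> j)"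
    proof (rule sum.cong)
      fix j assume "j \<in> {p..q}"
      then show "y j - x i = \<delta> j" using y[of j] xc[of j] pq bk bk1 k by auto
    qed simp
    then show "\<bar>\<Sum>j=p..q. y j - x i\<bar> \<le> M * sqrt (real (q + 1 - p))"
      using noise[of p q] pq bk bk1 by simp
  qed (use k bk bk1 in auto)
  also have "b (k + 1) - 1 + 1 = b (k + 1)" using k by simp
  also have "max (M / sqrt (real (min (i + 1 - b k) (b (k + 1) - i))))
      (max (M\<^sup>2 / (4 * lam)) (lam / real (b (k + 1) - b k) + M / sqrt (real (b (k + 1) - b k))))
    \<le> max (M / sqrt (real (min (i + 1 - b k) (b (k + 1) - i)))) (max (M\<^sup>2 / (4 * lam))
      (2 * lam / real (b (k + 1) - b k) + 2 * M / sqrt (real (b (k + 1) - b k))))"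
    using lam M by (intro max.mono order_refl add_mono divide_right_mono) auto
  finally show ?thesis
    by (simp add: boundary_dist_def piece_length_def k_def)
qed

theorem theorem3p1:
  fixes M :: "'a measure"
    and eps y xhat :: "'a \<Rightarrow> nat \<Rightarrow> real"
    and x :: "nat \<Rightarrow> real"
    and n K :: nat and b :: "nat \<Rightarrow> nat"
    and lam \<sigma> t M_y :: real
  assumes "prob_space M"
    and "lam > 0" and "\<sigma> > 0" and "t \<ge> 1"
    and "breakpoints n K b"
    and "constant_on_pieces K b x"
    and "prob_space.indep_vars M (\<lambda>_. borel) (\<lambda>i \<omega>. eps \<omega> i) {1..n}"
    and "\<And>i. i \<in> {1..n} \<Longrightarrow> distributed M lborel (\<lambda>\<omega>. eps \<omega> i) (normal_density 0 \<sigma>)"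
    and "\<And>\<omega> i. \<omega> \<in> space M \<Longrightarrow> i \<in> {1..n} \<Longrightarrow> y \<omega> i = x i + eps \<omega> i"
    and "\<And>\<omega>. \<omega> \<in> space M \<Longrightarrow> tv_minimizer n lam (y \<omega>) (xhat \<omega>)"
    and "M_y = 2 * \<sigma> * sqrt (ln (real n) + ln t)"
  shows "\<P>(\<omega> in M. \<forall>i\<in>{1..n}. \<bar>xhat \<omega> i - x i\<bar> \<le>
             Max {M_y / sqrt (real (boundary_dist K b i)),
                  M_y\<^sup>2 / (4 * lam),
                  2 * lam / real (piece_length b (piece_index K b i))
                    + 2 * M_y / sqrt (real (piece_length b (piece_index K b i)))})
         \<ge> 1 - 1 / t\<^sup>2"
proof -
  interpret prob_space M by fact
  let ?bound = "\<lambda>i. Max {M_y / sqrt (real (boundary_dist K b i)), M_y\<^sup>2 / (4 * lam),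
    2 * lam / real (piece_length b (piece_index K b i))
      + 2 * M_y / sqrt (real (piece_length b (piece_index K b i)))}"
  let ?good = "{\<omega>\<in>space M. \<forall>p\<in>{1..n}. \<forall>q\<in>{p..n}.
    \<bar>\<Sum>j=p..q. eps \<omega> j\<bar> \<le> M_y * sqrt (real (q + 1 - p))}"
  have n: "n \<ge> 1" using assms(5) by (auto simp: breakpoints_def)
  have M_y: "M_y \<ge> 0" using assms(3,4,11) n by simp
  have yM: "(\<lambda>\<omega>. y \<omega> j) \<in> borel_measurable M" if "j \<in> {1..n}" for j
  proof -
    have "(\<lambda>\<omega>. x j + eps \<omega> j) \<in> borel_measurable M"
      using distributed_measurable[OF assms(8)[OF that]] by simp
    then show ?thesis by (subst measurable_cong[OF assms(9)[OF _ that]])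
  qed
  have xhat: "(\<lambda>\<omega>. xhat \<omega> i) \<in> borel_measurable M" if "i \<in> {1..n}" for i
    by (rule tv_minimizer_measurable[where y = y and xhat = xhat, OF assms(2) that yM assms(10)])
  have "1 - 1 / t\<^sup>2 \<le> prob ?good"
    by (rule all_interval_noise_bounded[OF assms(7,8,3) n assms(4,11)])
  also have "\<dots> \<le> prob {\<omega>\<in>space M. \<forall>i\<in>{1..n}. \<bar>xhat \<omega> i - x i\<bar> \<le> ?bound i}"
  proof (rule finite_measure_mono)
    show "?good \<subseteq> {\<omega>\<in>space M. \<forall>i\<in>{1..n}. \<bar>xhat \<omega> i - x i\<bar> \<le> ?bound i}"
    proof (intro subsetI CollectI conjI ballI)
      fix \<omega> i assume \<omega>: "\<omega> \<in> ?good" and i: "i \<in> {1..n}"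
      show "\<bar>xhat \<omega> i - x i\<bar> \<le> ?bound i"
      proof (rule piecewise_constant_deviation_le[OF assms(10) assms(2) M_y assms(5,6) _ _ i])
        show "y \<omega> j = x j + eps \<omega> j" if "j \<in> {1..n}" for j
          using assms(9) \<omega> that by blast
      qed (use \<omega> in auto)
    qed auto
    have "{\<omega>\<in>space M. \<bar>xhat \<omega> i - x i\<bar> \<le> ?bound i} \<in> events" if "i \<in> {1..n}" for i
      using xhat[OF that] by measurable
    then show "{\<omega>\<in>space M. \<forall>i\<in>{1..n}. \<bar>xhat \<omega> i - x i\<bar> \<le> ?bound i} \<in> events"
      by (rule sets.sets_Collect_finite_All') (use n in auto)
  qed
  finally show ?thesis .
qed

end
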